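(* Let $(G,\omega,\mu)$ be a spherically symmetric tree with root $o$ and branching function $b(r)=(r+1)^p$ for some $p\ge 1$. Let $0\le\alpha\le 1$ and let $$V:G\to\mathbb{R},\qquad V(x)=(1+\rho(x,o))^{-\alpha}.$$ If $\alpha+p>1$, then there exist infinitely many bounded solutions $u:G\to\mathbb{R}$ of $\Delta u-Vu=0$ in $G$. In particular, for any $\gamma\in\mathbb{R}$, $\gamma>0$, there exists a solution $u$ of $\Delta u-Vu=0$ in $G$ such that $$\lim_{x\to\infty}u(x)=\gamma .$$
   Context: A weighted graph is a triplet $(G,\omega,\mu)$ where $G$ is a countably infinite set, $\mu:G\to(0,+\infty)$ is the node measure, and $\omega:G\times G\to[0,+\infty)$ is the edge weight, satisfying $\omega(x,y)=\omega(y,x)$, $\omega(x,x)=0$ and $\sum_{y\in G}\omega(x,y)<\infty$ for all $x,y\in G$. Write $x\sim y$ if $\omega(x,y)>0$. A path is a finite sequence $x_0,\dots,x_n$ with $x_k\sim x_{k+1}$ for all $k$. The graph is connected if any two distinct vertices are joined by a path, and locally finite if every $x\in G$ has only finitely many $y$ with $x\sim y$. All graphs are assumed connected and locally finite. The combinatorial distance $\rho(x,y)$ is the least number of edges in a path between $x$ and $y$. For a fixed point $o\in G$ put $S_r=\{x\in G:\rho(x,o)=r\}$ for integers $r\ge 0$, and for $x\in S_r$ with $r\ge1$ define the outer and inner degrees $\mathfrak{D}_+(x)=\frac1{\mu(x)}\sum_{y\in S_{r+1}}\omega(x,y)$ and $\mathfrak{D}_-(x)=\frac1{\mu(x)}\sum_{y\in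 S_{r-1}}\omega(x,y)$. A spherically symmetric tree with root $o$ and branching function $b:\mathbb{N}\to\mathbb{N}$ (here $\mathbb{N}=\{1,2,\dots\}$) is a (connected, locally finite) weighted graph such that: $\omega$ takes values in $\{0,1\}$; $\omega(x,y)=0$ for all $x,y\in S_r$ and all $r$; $\mu(x)=1$ for every $x\in G$; and $\mathfrak{D}_+(x)=b(r)$, $\mathfrak{D}_-(x)=1$ for every $x\in S_r$ and every $r\in\mathbb{N}$. The Laplace operator is $\Delta f(x)=\frac1{\mu(x)}\sum_{y\in G}[f(y)-f(x)]\,\omega(x,y)$. A function $u:G\to\mathbb{R}$ is a solution of $\Delta u-Vu=0$ in $G$ if $\Delta u(x)-V(x)u(x)=0$ for every $x\in G$. The limit $x\to\infty$ means $\rho(x,o)\to+\infty$. *)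

theory Defs
  imports "HOL-Analysis.Analysis"
begin

text \<open>The vertex set of a graph is the universe of the type \<open>'a\<close>. A graph is given by its edge
  weight \<open>\<omega>\<close> and node measure \<open>\<mu>\<close>.\<close>

definition adjacent :: "('a \<Rightarrow> 'a \<Rightarrow> real) \<Rightarrow> 'a \<Rightarrow> 'a \<Rightarrow> bool" where
  "adjacent \<omega> x y \<longleftrightarrow> \<omega> x y > 0"

definition is_path :: "('a \<Rightarrow> 'a \<Rightarrow> real) \<Rightarrow> 'a list \<Rightarrow> 'a \<Rightarrow> 'a \<Rightarrow> bool" where
  "is_path \<omega> xs x y \<longleftrightarrow> xs \<noteq> [] \<and> hd xs = x \<and> last xs = y \<and> successively (adjacent \<omega>) xs"

locale weighted_graph =
  fixes \<omega> :: "'a \<Rightarrow> 'a \<Rightarrow> real" and \<mu> :: "'a \<Rightarrow> real"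
  assumes countable_vertices: "countable (UNIV :: 'a set)"
    and infinite_vertices: "infinite (UNIV :: 'a set)"
    and measure_pos: "\<mu> x > 0"
    and weight_nonneg: "\<omega> x y \<ge> 0"
    and weight_sym: "\<omega> x y = \<omega> y x"
    and weight_diag: "\<omega> x x = 0"
    and weight_summable: "\<omega> x summable_on UNIV"

locale connected_locally_finite_graph = weighted_graph \<omega> \<mu>
  for \<omega> :: "'a \<Rightarrow> 'a \<Rightarrow> real" and \<mu> :: "'a \<Rightarrow> real" +
  assumes connected: "x \<noteq> y \<Longrightarrow> \<exists>xs. is_path \<omega> xs x y"
    and locally_finite: "finite {y. adjacent \<omega> x y}"

text \<open>A path with \<open>n\<close> edges is a list of length \<open>n + 1\<close>. The value is meaningful only if \<open>x\<close> and
  \<open>y\<close> are joined by a path, in particular on connected graphs.\<close>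

definition graph_dist :: "('a \<Rightarrow> 'a \<Rightarrow> real) \<Rightarrow> 'a \<Rightarrow> 'a \<Rightarrow> nat" where
  "graph_dist \<omega> x y = (LEAST n. \<exists>xs. is_path \<omega> xs x y \<and> length xs = n + 1)"

definition graph_sphere :: "('a \<Rightarrow> 'a \<Rightarrow> real) \<Rightarrow> 'a \<Rightarrow> nat \<Rightarrow> 'a set" where
  "graph_sphere \<omega> x\<^sub>0 r = {x. graph_dist \<omega> x x\<^sub>0 = r}"

definition outer_degree :: "('a \<Rightarrow> 'a \<Rightarrow> real) \<Rightarrow> ('a \<Rightarrow> real) \<Rightarrow> 'a \<Rightarrow> 'a \<Rightarrow> real" where
  "outer_degree \<omega> \<mu> x\<^sub>0 x =
     1 / \<mu> x * (\<Sum>\<^sub>\<infinity>y \<in> graph_sphere \<omega> x\<^sub>0 (graph_dist \<omega> x x\<^sub>0 + 1). \<omega> x y)"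

text \<open>Because of truncated subtraction, the inner degree is meaningful only for \<open>x \<noteq> x\<^sub>0\<close>.\<close>

definition inner_degree :: "('a \<Rightarrow> 'a \<Rightarrow> real) \<Rightarrow> ('a \<Rightarrow> real) \<Rightarrow> 'a \<Rightarrow> 'a \<Rightarrow> real" where
  "inner_degree \<omega> \<mu> x\<^sub>0 x =
     1 / \<mu> x * (\<Sum>\<^sub>\<infinity>y \<in> graph_sphere \<omega> x\<^sub>0 (graph_dist \<omega> x x\<^sub>0 - 1). \<omega> x y)"

text \<open>Only the values \<open>b r\<close> for \<open>r \<ge> 1\<close> matter: nothing beyond connectedness and local finiteness
  is required of the number of children of the root.\<close>

locale spherically_symmetric_tree = connected_locally_finite_graph \<omega> \<mu>
  for \<omega> :: "'a \<Rightarrow> 'a \<Rightarrow> real" and \<mu> :: "'a \<Rightarrow> real" +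
  fixes x\<^sub>0 :: 'a and b :: "nat \<Rightarrow> nat"
  assumes branching_pos: "r \<ge> 1 \<Longrightarrow> b r \<ge> 1"
    and weight_01: "\<omega> x y \<in> {0, 1}"
    and no_edge_in_sphere:
      "x \<in> graph_sphere \<omega> x\<^sub>0 r \<Longrightarrow> y \<in> graph_sphere \<omega> x\<^sub>0 r \<Longrightarrow> \<omega> x y = 0"
    and measure_one: "\<mu> x = 1"
    and outer_degree_eq:
      "r \<ge> 1 \<Longrightarrow> x \<in> graph_sphere \<omega> x\<^sub>0 r \<Longrightarrow> outer_degree \<omega> \<mu> x\<^sub>0 x = real (b r)"
    and inner_degree_eq:
      "r \<ge> 1 \<Longrightarrow> x \<in> graph_sphere \<omega> x\<^sub>0 r \<Longrightarrow> inner_degree \<omega> \<mu> x\<^sub>0 x = 1"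

definition laplacian :: "('a \<Rightarrow> 'a \<Rightarrow> real) \<Rightarrow> ('a \<Rightarrow> real) \<Rightarrow> ('a \<Rightarrow> real) \<Rightarrow> 'a \<Rightarrow> real" where
  "laplacian \<omega> \<mu> f x = 1 / \<mu> x * (\<Sum>\<^sub>\<infinity>y. (f y - f x) * \<omega> x y)"

definition is_solution ::
  "('a \<Rightarrow> 'a \<Rightarrow> real) \<Rightarrow> ('a \<Rightarrow> real) \<Rightarrow> ('a \<Rightarrow> real) \<Rightarrow> ('a \<Rightarrow> real) \<Rightarrow> bool" where
  "is_solution \<omega> \<mu> V u \<longleftrightarrow> (\<forall>x. laplacian \<omega> \<mu> u x - V x * u x = 0)"

text \<open>The filter of \<open>x \<rightarrow> \<infinity>\<close>, i.e. of \<open>graph_dist \<omega> x x\<^sub>0 \<rightarrow> \<infinity>\<close>.\<close>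

definition graph_at_infinity :: "('a \<Rightarrow> 'a \<Rightarrow> real) \<Rightarrow> 'a \<Rightarrow> 'a filter" where
  "graph_at_infinity \<omega> x\<^sub>0 = filtercomap (\<lambda>x. graph_dist \<omega> x x\<^sub>0) at_top"

end

theory Submission
  imports Defs
begin

text \<open>Look for a radial solution \<open>u x = f (\<rho> x)\<close>, where \<open>\<rho> x\<close> is the distance of \<open>x\<close> from the root.
  In a graph without edges inside spheres, the Laplacian of such a function at a vertex of \<open>S\<^sub>r\<close>
  only sees the outer and inner degree, so the equation becomes the second order recurrence
  \<open>B r * (f (r + 1) - f r) = (f r - f (r - 1)) + c r * f r\<close>, where \<open>B\<close> is the outer degree and
  \<open>c\<close> the potential as a function of the distance (lemma \<open>laplacian_radial\<close>). At the root, where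
  there is no inner degree, truncated subtraction makes the term \<open>f r - f (r - 1)\<close> vanish, so that
  the same recurrence covers all vertices.

  The recurrence can be solved outwards from \<open>f 0 = 1\<close>. As \<open>c \<ge> 0\<close>, the solution is increasing,
  and everything hinges on its boundedness. For \<open>r \<ge> 1\<close>, the increment \<open>f (r + 1) - f r\<close> is at most half of the
  previous one plus \<open>c r / B r * f r\<close>, because \<open>B r \<ge> 2\<close>. Hence the carried-over increments do
  not accumulate, and a discrete Gronwall argument bounds \<open>f\<close> by a multiple of
  \<open>exp (2 * (\<Sum>r. c r / B r))\<close> (lemma \<open>radial_recurrence_convergent\<close>). Here
  \<open>c r / B r = (r + 1) powr (- (\<alpha> + p))\<close> for \<open>r \<ge> 1\<close>, which is summable because \<open>\<alpha> + p > 1\<close>.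
  So \<open>f\<close> converges to a positive limit, and the multiples of the radial solution have every positive
  limit and are infinitely many bounded solutions.\<close>

section \<open>The Laplacian of a radial function\<close>

context connected_locally_finite_graph
begin

lemma ex_path: "\<exists>xs. is_path \<omega> xs x y"
proof (cases "x = y")
  case True
  then have "is_path \<omega> [x] x y" by (simp add: is_path_def)
  then show ?thesis by blast
qed (rule connected)

lemma shortest_path_exists: "\<exists>xs. is_path \<omega> xs x y \<and> length xs = graph_dist \<omega> x y + 1"
proof -
  obtain xs where xs: "is_path \<omega> xs x y"
    using ex_path by blast
  then have "length xs = (length xs - 1) + 1"
    by (cases xs) (auto simp: is_path_def)
  with xs have "\<exists>n xs. is_path \<omega> xs x y \<and> length xs = n + 1"
    by blast
  then show ?thesis
    unfolding graph_dist_def by (rule LeastI_ex)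
qed

lemma graph_dist_eq_0_iff: "graph_dist \<omega> x y = 0 \<longleftrightarrow> x = y"
proof
  assume "graph_dist \<omega> x y = 0"
  with shortest_path_exists[of x y] obtain xs where "is_path \<omega> xs x y" "length xs = 1"
    by auto
  then show "x = y"
    by (auto simp: is_path_def length_Suc_conv)
next
  assume "x = y"
  then have "is_path \<omega> [x] x y \<and> length [x] = 0 + 1" by (simp add: is_path_def)
  then show "graph_dist \<omega> x y = 0"
    unfolding graph_dist_def by (intro Least_eq_0) blast
qed

lemma graph_dist_adjacent_le:
  assumes "adjacent \<omega> x y"
  shows "graph_dist \<omega> x z \<le> graph_dist \<omega> y z + 1"
proof -
  obtain ys where ys: "is_path \<omega> ys y z" "length ys = graph_dist \<omega> y z + 1"
    using shortest_path_exists by blast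
  with assms have "is_path \<omega> (x # ys) x z \<and> length (x # ys) = (graph_dist \<omega> y z + 1) + 1"
    by (auto simp: is_path_def successively_Cons)
  then show ?thesis
    unfolding graph_dist_def[of _ x z] by (intro Least_le) blast
qed

lemma adjacent_sym: "adjacent \<omega> x y \<longleftrightarrow> adjacent \<omega> y x"
  by (simp add: adjacent_def weight_sym[of x y])

lemma has_neighbour: "\<exists>y. adjacent \<omega> x y"
proof -
  obtain z where "z \<noteq> x"
    using infinite_vertices by (metis (full_types) UNIV_eq_I finite.emptyI finite_insert singleton_iff)
  then obtain xs where xs: "is_path \<omega> xs x z"
    using connected by metis
  with \<open>z \<noteq> x\<close> obtain y ys where "xs = x # y # ys"
    by (cases xs; cases "tl xs") (auto simp: is_path_def)
  with xs show ?thesis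
    by (auto simp: is_path_def)
qed

lemma infsum_neighbours:
  fixes g :: "'a \<Rightarrow> real"
  shows "(\<Sum>\<^sub>\<infinity>y\<in>A. g y * \<omega> x y) = (\<Sum>y | adjacent \<omega> x y \<and> y \<in> A. g y * \<omega> x y)"
proof -
  have "\<omega> x y = 0" if "\<not> adjacent \<omega> x y" for y
    using that weight_nonneg[of x y] by (simp add: adjacent_def)
  then have "(\<Sum>\<^sub>\<infinity>y\<in>A. g y * \<omega> x y) = (\<Sum>\<^sub>\<infinity>y\<in>{y. adjacent \<omega> x y \<and> y \<in> A}. g y * \<omega> x y)"
    by (intro infsum_cong_neutral) auto
  also have "finite {y. adjacent \<omega> x y \<and> y \<in> A}"
    by (rule finite_subset[OF _ locally_finite[of x]]) auto
  ultimately show ?thesis by simp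
qed

lemma outer_degree_root_pos:
  assumes no_edge: "\<And>r x y. x \<in> graph_sphere \<omega> o' r \<Longrightarrow> y \<in> graph_sphere \<omega> o' r \<Longrightarrow> \<omega> x y = 0"
  shows "outer_degree \<omega> \<mu> o' o' > 0"
proof -
  obtain y where y: "adjacent \<omega> o' y"
    using has_neighbour by blast
  have "graph_dist \<omega> y o' \<le> 1"
    using graph_dist_adjacent_le[of y o' o'] y adjacent_sym graph_dist_eq_0_iff[of o' o'] by auto
  moreover have "y \<noteq> o'"
    using y weight_diag[of o'] by (auto simp: adjacent_def)
  ultimately have dist: "graph_dist \<omega> y o' = 1"
    using graph_dist_eq_0_iff[of y o'] by linarith
  let ?N = "{y. adjacent \<omega> o' y \<and> y \<in> graph_sphere \<omega> o' 1}"
  have "(\<Sum>\<^sub>\<infinity>y\<in>graph_sphere \<omega> o' 1. \<omega> o' y) = (\<Sum>y\<in>?N. \<omega> o' y)"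
    using infsum_neighbours[of "\<lambda>_. 1" o' "graph_sphere \<omega> o' 1"] by simp
  also have "\<dots> > 0"
  proof (rule sum_pos)
    show "finite ?N"
      by (rule finite_subset[OF _ locally_finite[of o']]) auto
    show "?N \<noteq> {}"
      using y dist by (auto simp: graph_sphere_def)
  qed (simp add: adjacent_def)
  finally show ?thesis
    using measure_pos[of o'] graph_dist_eq_0_iff[of o' o'] by (simp add: outer_degree_def)
qed

text \<open>A neighbour of \<open>x\<close> lies at distance \<open>r - 1\<close>, \<open>r\<close> or \<open>r + 1\<close> from the base point, and the middle
  case is excluded. For \<open>r = 0\<close>, truncated subtraction turns the inner sphere into \<open>S\<^sub>0\<close> itself; its
  contribution has the factor \<open>f 0 - f 0\<close>, so the formula remains correct.\<close>

lemma laplacian_radial: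
  fixes f :: "nat \<Rightarrow> real"
  assumes no_edge: "\<And>r x y. x \<in> graph_sphere \<omega> o' r \<Longrightarrow> y \<in> graph_sphere \<omega> o' r \<Longrightarrow> \<omega> x y = 0"
    and r: "graph_dist \<omega> x o' = r"
  shows "laplacian \<omega> \<mu> (\<lambda>x. f (graph_dist \<omega> x o')) x =
    (f (r + 1) - f r) * outer_degree \<omega> \<mu> o' x + (f (r - 1) - f r) * inner_degree \<omega> \<mu> o' x"
proof -
  define N where "N k = {y. adjacent \<omega> x y \<and> y \<in> graph_sphere \<omega> o' k}" for k
  have fin: "finite (N k)" for k
    unfolding N_def by (rule finite_subset[OF _ locally_finite[of x]]) auto
  have "graph_dist \<omega> y o' \<in> {r - 1, r + 1}" if y: "adjacent \<omega> x y" for y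
  proof -
    have "graph_dist \<omega> y o' \<noteq> r"
      using y no_edge[of x r y] r by (auto simp: adjacent_def graph_sphere_def)
    then show ?thesis
      using graph_dist_adjacent_le[of x y o'] graph_dist_adjacent_le[of y x o'] y adjacent_sym r
      by auto
  qed
  then have N: "{y. adjacent \<omega> x y} = N (r + 1) \<union> N (r - 1)"
    by (auto simp: N_def graph_sphere_def)
  have disj: "N (r + 1) \<inter> N (r - 1) = {}"
    by (auto simp: N_def graph_sphere_def)
  have const: "(\<Sum>y\<in>N k. (f (graph_dist \<omega> y o') - f r) * \<omega> x y) =
      (f k - f r) * (\<Sum>\<^sub>\<infinity>y\<in>graph_sphere \<omega> o' k. \<omega> x y)" for k
    using infsum_neighbours[of "\<lambda>_. 1" x "graph_sphere \<omega> o' k"]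
    by (auto simp: sum_distrib_left N_def graph_sphere_def intro!: sum.cong)
  have "(\<Sum>\<^sub>\<infinity>y. (f (graph_dist \<omega> y o') - f r) * \<omega> x y) =
      (\<Sum>y\<in>N (r + 1) \<union> N (r - 1). (f (graph_dist \<omega> y o') - f r) * \<omega> x y)"
    using infsum_neighbours[of "\<lambda>y. f (graph_dist \<omega> y o') - f r" x UNIV] N by simp
  also have "\<dots> = (f (r + 1) - f r) * (\<Sum>\<^sub>\<infinity>y\<in>graph_sphere \<omega> o' (r + 1). \<omega> x y)
      + (f (r - 1) - f r) * (\<Sum>\<^sub>\<infinity>y\<in>graph_sphere \<omega> o' (r - 1). \<omega> x y)"
    by (simp only: sum.union_disjoint[OF fin fin disj] const)
  finally show ?thesis
    by (simp add: laplacian_def outer_degree_def inner_degree_def r add_divide_distrib)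
qed

end

section \<open>The radial recurrence\<close>

fun radial_solution :: "(nat \<Rightarrow> real) \<Rightarrow> (nat \<Rightarrow> real) \<Rightarrow> nat \<Rightarrow> real" where
  "radial_solution B c 0 = 1"
| "radial_solution B c (Suc 0) = 1 + c 0 / B 0"
| "radial_solution B c (Suc (Suc n)) = radial_solution B c (Suc n) +
    (radial_solution B c (Suc n) - radial_solution B c n
      + c (Suc n) * radial_solution B c (Suc n)) / B (Suc n)"

lemma radial_solution_recurrence:
  assumes "B n \<noteq> 0"
  shows "B n * (radial_solution B c (n + 1) - radial_solution B c n) =
    radial_solution B c n - radial_solution B c (n - 1) + c n * radial_solution B c n"
  using assms by (cases n) auto

lemma radial_recurrence_increasing:
  fixes f B c :: "nat \<Rightarrow> real"
  assumes rec: "\<And>n. B n * (f (n + 1) - f n) = f n - f (n - 1) + c n * f n"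
    and "f 0 = 1" and "\<And>n. B n > 0" and "\<And>n. c n \<ge> 0"
  shows "1 \<le> f n \<and> f n \<le> f (Suc n)"
proof (induction n)
  case 0
  have "B 0 * (f 1 - f 0) \<ge> 0"
    using rec[of 0] assms by simp
  then show ?case
    using assms by (simp add: zero_le_mult_iff not_le[symmetric])
next
  case (Suc n)
  then have "B (Suc n) * (f (Suc (Suc n)) - f (Suc n)) \<ge> 0"
    using rec[of "Suc n"] assms(4)[of "Suc n"] by simp
  then show ?case
    using Suc assms(3)[of "Suc n"] by (simp add: zero_le_mult_iff not_le[symmetric])
qed

text \<open>The quantity \<open>g n = 2 * f (n + 1) - f n\<close>, i.e. \<open>f (n + 1)\<close> plus the last increment, absorbs the
  increment that the recurrence carries over: as \<open>B (n + 1) \<ge> 2\<close>, it satisfies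
  \<open>g (n + 1) \<le> (1 + 2 * a (n + 1)) * g n\<close> with \<open>a = c / B\<close>. So it grows at most like the product of
  the factors \<open>1 + 2 * a\<close>, which is bounded as \<open>a\<close> is summable.\<close>

lemma radial_recurrence_convergent:
  fixes f B c :: "nat \<Rightarrow> real"
  assumes rec: "\<And>n. B n * (f (n + 1) - f n) = f n - f (n - 1) + c n * f n"
    and f0: "f 0 = 1" and B0: "B 0 > 0" and B: "\<And>n. B (Suc n) \<ge> 2" and c: "\<And>n. c n \<ge> 0"
    and summable: "summable (\<lambda>n. c n / B n)"
  shows "\<exists>L\<ge>1. f \<longlonglongrightarrow> L"
proof -
  have Bpos: "B n > 0" for n
    using B0 B[of "n - 1"] by (cases n) auto
  have mono: "1 \<le> f n" "f n \<le> f (Suc n)" for n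
    using radial_recurrence_increasing[of B f c n] rec f0 Bpos c by auto
  define a where "a n = c n / B n" for n
  have a_nonneg: "a n \<ge> 0" for n
    using c[of n] Bpos[of n] by (simp add: a_def)
  define g where "g n = 2 * f (Suc n) - f n" for n
  have fg: "f (Suc n) \<le> g n" for n
    using mono(2)[of n] by (simp add: g_def)
  have g_nonneg: "g n \<ge> 0" for n
    using fg[of n] mono(1)[of "Suc n"] by linarith
  have step: "g (Suc n) \<le> (1 + 2 * a (Suc n)) * g n" for n
  proof -
    have "f (Suc (Suc n)) - f (Suc n) = (f (Suc n) - f n) / B (Suc n) + a (Suc n) * f (Suc n)"
    proof -
      have "f (Suc (Suc n)) - f (Suc n) = (f (Suc n) - f n + c (Suc n) * f (Suc n)) / B (Suc n)"
        using rec[of "Suc n"] Bpos[of "Suc n"] by (simp add: nonzero_eq_divide_eq mult.commute)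
      then show ?thesis
        by (simp add: a_def add_divide_distrib)
    qed
    moreover have "(f (Suc n) - f n) / B (Suc n) \<le> (f (Suc n) - f n) / 2"
      using mono(2)[of n] B[of n] by (intro divide_left_mono) auto
    moreover have "a (Suc n) * f (Suc n) \<le> a (Suc n) * g n"
      by (intro mult_left_mono fg a_nonneg)
    ultimately show ?thesis
      by (simp add: g_def algebra_simps)
  qed
  have "g n \<le> g 0 * exp (2 * sum a {..n})" for n
  proof (induction n)
    case 0
    have "1 \<le> exp (2 * a 0)" using a_nonneg[of 0] by simp
    from mult_left_mono[OF this g_nonneg[of 0]] show ?case by simp
  next
    case (Suc n)
    have "g (Suc n) \<le> (1 + 2 * a (Suc n)) * g n" by (rule step)
    also have "\<dots> \<le> exp (2 * a (Suc n)) * (g 0 * exp (2 * sum a {..n}))"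
      using Suc g_nonneg[of n] exp_ge_add_one_self[of "2 * a (Suc n)"] by (intro mult_mono) auto
    also have "\<dots> = g 0 * exp (2 * sum a {..Suc n})"
      by (simp add: exp_add algebra_simps)
    finally show ?case .
  qed
  moreover have "sum a {..n} \<le> suminf a" for n
    using summable a_nonneg by (intro sum_le_suminf) (auto simp: a_def[abs_def])
  ultimately have "g n \<le> g 0 * exp (2 * suminf a)" for n
    using g_nonneg[of 0] by (meson exp_le_cancel_iff mult_left_mono order_trans zero_le_numeral)
  then have "f (Suc n) \<le> g 0 * exp (2 * suminf a)" for n
    using fg[of n] order_trans by blast
  then have "f n \<le> g 0 * exp (2 * suminf a)" for n
    using mono(2)[of n] order_trans by blast
  then obtain L where "f \<longlonglongrightarrow> L" "\<forall>n. f n \<le> L"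
    using incseq_convergent[of f] mono(2) by (metis incseq_SucI)
  then show ?thesis
    using mono(1)[of 0] order_trans by blast
qed

section \<open>Bounded solutions on the tree\<close>

theorem theorem3p7:
  fixes \<omega> :: "'a \<Rightarrow> 'a \<Rightarrow> real" and \<mu> :: "'a \<Rightarrow> real" and x\<^sub>0 :: 'a
    and b :: "nat \<Rightarrow> nat" and p \<alpha> :: real and V :: "'a \<Rightarrow> real"
  assumes "spherically_symmetric_tree \<omega> \<mu> x\<^sub>0 b"
    and "p \<ge> 1"
    and "\<And>r. r \<ge> 1 \<Longrightarrow> real (b r) = (real r + 1) powr p"
    and "0 \<le> \<alpha>" and "\<alpha> \<le> 1"
    and "\<And>x. V x = (1 + real (graph_dist \<omega> x x\<^sub>0)) powr (- \<alpha>)"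
    and "\<alpha> + p > 1"
  shows "infinite {u :: 'a \<Rightarrow> real. is_solution \<omega> \<mu> V u \<and> bounded (range u)} \<and>
    (\<forall>\<gamma>::real. \<gamma> > 0 \<longrightarrow>
      (\<exists>u :: 'a \<Rightarrow> real. is_solution \<omega> \<mu> V u \<and> (u \<longlongrightarrow> \<gamma>) (graph_at_infinity \<omega> x\<^sub>0)))"
proof -
  interpret spherically_symmetric_tree \<omega> \<mu> x\<^sub>0 b by (rule assms(1))
  define c where "c n = (1 + real n) powr (- \<alpha>)" for n
  \<comment> \<open>The degree of the root is not prescribed by the branching function.\<close>
  define B where "B n = (if n = 0 then outer_degree \<omega> \<mu> x\<^sub>0 x\<^sub>0 else real (b n))" for n
  define f where "f = radial_solution B c"
  have f0: "f 0 = 1"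
    by (simp add: f_def)
  have B0: "B 0 > 0"
    using outer_degree_root_pos[of x\<^sub>0] no_edge_in_sphere by (simp add: B_def)
  have B_Suc: "B (Suc n) = (1 + real (Suc n)) powr p" for n
    using assms(3)[of "Suc n"] by (simp add: B_def add_ac)
  have B2: "B (Suc n) \<ge> 2" for n
  proof -
    have "2 \<le> (1 + real (Suc n)) powr 1" by simp
    also have "\<dots> \<le> (1 + real (Suc n)) powr p"
      using assms(2) by (intro powr_mono) auto
    finally show ?thesis by (simp only: B_Suc)
  qed
  have "B n \<noteq> 0" for n
    using B0 B2[of "n - 1"] by (cases n) auto
  then have rec: "B n * (f (n + 1) - f n) = f n - f (n - 1) + c n * f n" for n
    unfolding f_def by (intro radial_solution_recurrence) auto
  have "c (Suc n) / B (Suc n) = real (n + 2) powr (- (\<alpha> + p))" for n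
    by (simp add: c_def B_Suc powr_diff[symmetric] add_ac)
  moreover have "summable (\<lambda>n. real (n + 2) powr (- (\<alpha> + p)))"
    using assms(7) by (subst summable_iff_shift) (simp add: summable_real_powr_iff)
  ultimately have "summable (\<lambda>n. c (Suc n) / B (Suc n))"
    by simp
  then have "summable (\<lambda>n. c n / B n)"
    by (subst (asm) summable_Suc_iff)
  then obtain L where L: "L \<ge> 1" "f \<longlonglongrightarrow> L"
    using radial_recurrence_convergent[of B f c] rec f0 B0 B2 by (auto simp: c_def)
  define u where "u s x = s * f (graph_dist \<omega> x x\<^sub>0)" for s x
  have sol: "is_solution \<omega> \<mu> V (u s)" for s
    unfolding is_solution_def
  proof
    fix x
    define r where "r = graph_dist \<omega> x x\<^sub>0"
    have outer: "outer_degree \<omega> \<mu> x\<^sub>0 x = B r"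
      using outer_degree_eq[of r x] graph_dist_eq_0_iff[of x x\<^sub>0]
      by (cases "r = 0") (auto simp: B_def r_def graph_sphere_def)
    have inner: "(f (r - 1) - f r) * inner_degree \<omega> \<mu> x\<^sub>0 x = f (r - 1) - f r"
      using inner_degree_eq[of r x] by (cases "r = 0") (auto simp: r_def graph_sphere_def)
    have "laplacian \<omega> \<mu> (u s) x =
      (s * f (r + 1) - s * f r) * B r + (s * f (r - 1) - s * f r) * inner_degree \<omega> \<mu> x\<^sub>0 x"
      unfolding u_def outer[symmetric] using no_edge_in_sphere r_def
      by (intro laplacian_radial[where f = "\<lambda>n. s * f n"]) auto
    also have "\<dots> = s * (B r * (f (r + 1) - f r) +
        (f (r - 1) - f r) * inner_degree \<omega> \<mu> x\<^sub>0 x)"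
      by (simp add: algebra_simps)
    also have "\<dots> = s * (c r * f r)"
      unfolding inner rec by simp
    finally show "laplacian \<omega> \<mu> (u s) x - V x * u s x = 0"
      by (simp add: assms(6) c_def u_def r_def)
  qed
  have bdd: "bounded (range (u s))" for s
  proof -
    have "bounded (range f)"
      using L(2) by (rule convergent_imp_bounded)
    then have "bounded ((\<lambda>y. s *\<^sub>R y) ` range f)"
      by (rule bounded_scaling)
    then show ?thesis
      by (rule bounded_subset) (auto simp: u_def)
  qed
  have "u s x\<^sub>0 = s" for s
    using graph_dist_eq_0_iff[of x\<^sub>0 x\<^sub>0] by (simp add: u_def f0)
  then have "inj u"
    by (metis injI)
  then have "infinite (range u)"
    using finite_imageD infinite_UNIV_char_0 by blast
  moreover have "range u \<subseteq> {u. is_solution \<omega> \<mu> V u \<and> bounded (range u)}"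
    using sol bdd by auto
  ultimately have "infinite {u. is_solution \<omega> \<mu> V u \<and> bounded (range u)}"
    using infinite_super by blast
  moreover have "(u (\<gamma> / L) \<longlongrightarrow> \<gamma>) (graph_at_infinity \<omega> x\<^sub>0)" for \<gamma>
  proof -
    have "((\<lambda>n. \<gamma> / L * f n) \<longlongrightarrow> \<gamma> / L * L) at_top"
      by (intro tendsto_intros L(2))
    then have "((\<lambda>x. \<gamma> / L * f (graph_dist \<omega> x x\<^sub>0)) \<longlongrightarrow> \<gamma> / L * L) (graph_at_infinity \<omega> x\<^sub>0)"
      unfolding graph_at_infinity_def by (rule filterlim_compose) (rule filterlim_filtercomap)
    then show ?thesis
      using L(1) by (simp add: u_def[abs_def])
  qed
  ultimately show ?thesis
    using sol by blast
qed

end
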